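(* Let $D$ be a set, let $X$ be a real linear space, let $f\colon D\to X$ be an admissible function and let $S\subseteq D$. Then $$\operatorname{conv}_f(S)=f^{(-1)}\big(\operatorname{conv}(f(S))\big).$$
   Context: Notation: $\mathbb{R}_+=(0,+\infty)$; $W_n=[0,+\infty)^n\setminus\{(0,\dots,0)\}$; $\operatorname{conv}$ is the ordinary convex hull in $X$. Admissible functions and generalized Bajraktarević means: For a nonzero $x$ in a real linear space $X$, the ray generated by $x$ is $R_x=\{\lambda x\mid\lambda\in\mathbb{R}_+\}$. For $S\subseteq X$, $\operatorname{cone}(S)=\{\lambda x\mid \lambda\in\mathbb{R}_+,\ x\in S\}$. A subset $S$ of $X$ is observable if the rays generated by any two distinct elements of $S$ are disjoint, and conically convex if $\operatorname{cone}(S)$ is convex and $0\notin\operatorname{conv}(S)$. A function $f\colon D\to X$ is admissible if it is injective and $f(D)$ is observable and conically convex. For such $f$, $\pi_f\colon\operatorname{cone}(f(D))\to f(D)$ maps $y$ to the unique point $x\in f(D)$ with $y\in R_x$, and $f^{(-1)}:=f^{-1}\circ\pi_f\colon\operatorname{cone}(f(D))\to D$; for a subset $T\subseteq\operatorname{cone}(f(D))$, $f^{(-1)}(T)$ is the image of $T$ under the map $f^{(-1)}$. For $(x,\lambda)\in D^n\times W_n$ put $\mathscr{B}_f(x,\lambda)=f^{(-1)}\big(\sum_{k=1}^n\lambda_kf(x_k)\big)$. A subset $S\subseteq D$ is $f$-convex if $\mathscr{B}_f(x,\lambda)\in S$ for all $n\in\mathbb{N}$ and $(x,\lambda)\in S^n\times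 W_n$. The $f$-convex hull $\operatorname{conv}_f(S)$ of $S\subseteq D$ is the smallest $f$-convex subset of $D$ containing $S$ (i.e. the intersection of all $f$-convex subsets of $D$ containing $S$). *)

theory Defs
  imports "HOL-Analysis.Analysis"
begin

text \<open>
  Rays and cones are open at the origin (strictly positive factors), unlike the library's
  \<^term>\<open>cone hull S\<close>, which contains \<open>0\<close> for nonempty \<open>S\<close>.
  The origin generates no ray in the mathematical sense; here \<open>ray 0 = {0}\<close>, which plays no role
  because conical convexity excludes \<open>0\<close> from the set.
\<close>

definition ray :: "'x::real_vector \<Rightarrow> 'x set" where
  "ray x = {c *\<^sub>R x | c. 0 < c}"

definition cone_of :: "'x::real_vector set \<Rightarrow> 'x set" where
  "cone_of S = {c *\<^sub>R x | c x. 0 < c \<and> x \<in> S}"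

definition observable :: "'x::real_vector set \<Rightarrow> bool" where
  "observable S \<longleftrightarrow> (\<forall>x\<in>S. \<forall>y\<in>S. x \<noteq> y \<longrightarrow> ray x \<inter> ray y = {})"

definition conically_convex :: "'x::real_vector set \<Rightarrow> bool" where
  "conically_convex S \<longleftrightarrow> convex (cone_of S) \<and> 0 \<notin> convex hull S"

definition admissible :: "'d set \<Rightarrow> ('d \<Rightarrow> 'x::real_vector) \<Rightarrow> bool" where
  "admissible D f \<longleftrightarrow> inj_on f D \<and> observable (f ` D) \<and> conically_convex (f ` D)"

text \<open>
  The maps \<open>\<pi>\<^sub>f\<close> and \<open>f\<^sup>(\<^sup>-\<^sup>1\<^sup>)\<close> have domain \<^term>\<open>cone_of (f ` D)\<close>;
  their values elsewhere are unspecified.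
\<close>

definition ray_proj :: "'d set \<Rightarrow> ('d \<Rightarrow> 'x::real_vector) \<Rightarrow> 'x \<Rightarrow> 'x" where
  "ray_proj D f y = (THE x. x \<in> f ` D \<and> y \<in> ray x)"

definition gen_inv :: "'d set \<Rightarrow> ('d \<Rightarrow> 'x::real_vector) \<Rightarrow> 'x \<Rightarrow> 'd" where
  "gen_inv D f = the_inv_into D f \<circ> ray_proj D f"

text \<open>
  An \<open>n\<close>-tuple over \<open>A\<close> is an element of \<^term>\<open>{1..n} \<rightarrow>\<^sub>E A\<close>. In particular
  \<open>weights 0\<close> is empty, so \<open>n = 0\<close> contributes nothing below.
\<close>

definition weights :: "nat \<Rightarrow> (nat \<Rightarrow> real) set" where
  "weights n = ({1..n} \<rightarrow>\<^sub>E {0..}) - {\<lambda>k\<in>{1..n}. 0}"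

definition bajraktarevic ::
    "'d set \<Rightarrow> ('d \<Rightarrow> 'x::real_vector) \<Rightarrow> nat \<Rightarrow> (nat \<Rightarrow> 'd) \<Rightarrow> (nat \<Rightarrow> real) \<Rightarrow> 'd" where
  "bajraktarevic D f n x l = gen_inv D f (\<Sum>k=1..n. l k *\<^sub>R f (x k))"

definition f_convex :: "'d set \<Rightarrow> ('d \<Rightarrow> 'x::real_vector) \<Rightarrow> 'd set \<Rightarrow> bool" where
  "f_convex D f S \<longleftrightarrow>
     S \<subseteq> D \<and> (\<forall>n. \<forall>x\<in>{1..n} \<rightarrow>\<^sub>E S. \<forall>l\<in>weights n. bajraktarevic D f n x l \<in> S)"

definition conv_f :: "'d set \<Rightarrow> ('d \<Rightarrow> 'x::real_vector) \<Rightarrow> 'd set \<Rightarrow> 'd set" where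
  "conv_f D f S = f_convex D f hull S"

end

theory Submission
  imports Defs
begin

text \<open>
  The map \<open>f\<^sup>(\<^sup>-\<^sup>1\<^sup>)\<close> is constant on rays (\<open>gen_inv_scaleR\<close>), so it cannot tell a linear combination
  with nonnegative, not all vanishing, coefficients from the convex combination obtained by
  normalising the coefficients.  Up to this normalisation, Bajraktarevic means of points of \<open>S\<close>
  are the images under \<open>f\<^sup>(\<^sup>-\<^sup>1\<^sup>)\<close> of convex combinations of points of \<open>f ` S\<close>.

  One inclusion follows at once: a point of \<open>convex hull (f ` S)\<close> is a sum with weights of total
  \<open>1\<close>, so its image is a mean of points of \<open>S\<close> and lies in every \<open>f\<close>-convex set containing \<open>S\<close>.
  For the other one, the image of the convex hull must itself be \<open>f\<close>-convex.  If \<open>d\<close> is the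
  image of \<open>y\<close>, then \<open>f d\<close> is in general different from \<open>y\<close>, but it lies on the same ray, hence
  in the cone over the convex hull.  That cone is closed under the linear combinations in question
  (\<open>sum_mem_cone_of\<close>), and constancy on rays brings the result back to the convex hull.
\<close>

lemma cone_of_superset: "A \<subseteq> cone_of A"
  unfolding cone_of_def by (force intro: exI[of _ "1::real"])

text \<open>
  After division by the total weight the combination is a convex one.  Rescaling
  changes the individual weights by positive factors only, so the total remains positive.
\<close>

lemma sum_mem_cone_of:
  fixes l :: "'i \<Rightarrow> real" and z :: "'i \<Rightarrow> 'x::real_vector"
  assumes "convex Q" and "finite I"
    and z: "\<And>i. i \<in> I \<Longrightarrow> z i \<in> cone_of Q"
    and l: "\<And>i. i \<in> I \<Longrightarrow> 0 \<le> l i" and nonzero: "\<exists>i\<in>I. l i \<noteq> 0"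
  shows "(\<Sum>i\<in>I. l i *\<^sub>R z i) \<in> cone_of Q"
proof -
  have "\<forall>i\<in>I. \<exists>c y. 0 < c \<and> y \<in> Q \<and> z i = c *\<^sub>R y"
    using z unfolding cone_of_def by blast
  then obtain c y where cy: "\<And>i. i \<in> I \<Longrightarrow> 0 < c i \<and> y i \<in> Q \<and> z i = c i *\<^sub>R y i"
    by metis
  define m where "m = (\<Sum>i\<in>I. l i * c i)"
  have nonneg: "0 \<le> l i * c i" if "i \<in> I" for i
    using l[OF that] cy[OF that] by simp
  obtain j where j: "j \<in> I" "l j \<noteq> 0"
    using nonzero by blast
  have "0 < l j * c j"
    using l[OF j(1)] j(2) cy[OF j(1)] by simp
  then have m: "0 < m"
    unfolding m_def using \<open>finite I\<close> j(1) nonneg by (intro sum_pos2[of I j]) auto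
  have "(\<Sum>i\<in>I. (l i * c i / m) *\<^sub>R y i) \<in> Q"
  proof (rule convex_sum[OF \<open>finite I\<close> \<open>convex Q\<close>])
    show "(\<Sum>i\<in>I. l i * c i / m) = 1"
      using m by (simp add: m_def flip: sum_divide_distrib)
  qed (use cy nonneg m in auto)
  moreover have "(\<Sum>i\<in>I. l i *\<^sub>R z i) = m *\<^sub>R (\<Sum>i\<in>I. (l i * c i / m) *\<^sub>R y i)"
    using m cy by (auto simp: scaleR_sum_right intro!: sum.cong)
  ultimately show ?thesis
    using m unfolding cone_of_def by blast
qed

text \<open>
  Observability makes the description of \<^const>\<open>ray_proj\<close> unique: a second point of \<open>f ` D\<close>
  whose ray passes through \<open>c *\<^sub>R f d\<close> would share that vector with the ray of \<open>f d\<close>.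
\<close>

lemma gen_inv_scaleR_image:
  assumes "admissible D f" and "d \<in> D" and "0 < c"
  shows "gen_inv D f (c *\<^sub>R f d) = d"
proof -
  have "ray_proj D f (c *\<^sub>R f d) = f d"
    unfolding ray_proj_def
  proof (rule the_equality)
    show "f d \<in> f ` D \<and> c *\<^sub>R f d \<in> ray (f d)"
      using assms unfolding ray_def by blast
    then show "x = f d" if "x \<in> f ` D \<and> c *\<^sub>R f d \<in> ray x" for x
      using that assms(1) unfolding admissible_def observable_def by blast
  qed
  then show ?thesis
    using assms by (simp add: gen_inv_def admissible_def the_inv_into_f_f)
qed

lemma gen_inv_cases:
  assumes "admissible D f" and "y \<in> cone_of (f ` D)"
  obtains c where "0 < c" and "gen_inv D f y \<in> D" and "y = c *\<^sub>R f (gen_inv D f y)"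
proof -
  obtain c d where cd: "0 < c" "d \<in> D" "y = c *\<^sub>R f d"
    using assms(2) unfolding cone_of_def by blast
  have "gen_inv D f y = d"
    unfolding cd(3) using gen_inv_scaleR_image[OF assms(1) cd(2,1)] .
  then show ?thesis
    using that[of c] cd by simp
qed

lemma gen_inv_scaleR:
  assumes "admissible D f" and "y \<in> cone_of (f ` D)" and "0 < c"
  shows "gen_inv D f (c *\<^sub>R y) = gen_inv D f y"
proof -
  obtain b where b: "0 < b" "gen_inv D f y \<in> D" "y = b *\<^sub>R f (gen_inv D f y)"
    using gen_inv_cases[OF assms(1,2)] .
  have "c *\<^sub>R y = (c * b) *\<^sub>R f (gen_inv D f y)"
    using arg_cong[OF b(3), of "scaleR c"] by (simp only: scaleR_scaleR)
  with gen_inv_scaleR_image[OF assms(1) b(2), of "c * b"] b(1) assms(3) show ?thesis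
    by simp
qed

text \<open>
  Conical convexity places convex combinations of points of \<open>f ` D\<close> in the domain of
  \<open>f\<^sup>(\<^sup>-\<^sup>1\<^sup>)\<close>.
\<close>

lemma convex_hull_subset_cone_of:
  assumes "admissible D f" and "S \<subseteq> D"
  shows "convex hull (f ` S) \<subseteq> cone_of (f ` D)"
proof (rule hull_minimal)
  show "f ` S \<subseteq> cone_of (f ` D)"
    using assms(2) cone_of_superset by blast
  show "convex (cone_of (f ` D))"
    using assms(1) unfolding admissible_def conically_convex_def by blast
qed

lemma weights_nonneg: "l \<in> weights n \<Longrightarrow> k \<in> {1..n} \<Longrightarrow> 0 \<le> l k"
  unfolding weights_def by (auto simp: PiE_iff)

lemma weights_nonzero:
  assumes "l \<in> weights n"
  shows "\<exists>k\<in>{1..n}. l k \<noteq> 0"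
proof (rule ccontr)
  assume "\<not> ?thesis"
  then have "l = (\<lambda>k\<in>{1..n}. 0)"
    using assms unfolding weights_def by (intro ext) (auto simp: PiE_iff extensional_def)
  then show False
    using assms unfolding weights_def by blast
qed

lemma f_convex_gen_inv_image:
  assumes adm: "admissible D f" and S: "S \<subseteq> D"
  shows "f_convex D f (gen_inv D f ` (convex hull (f ` S)))"
proof -
  define Q where "Q = convex hull (f ` S)"
  have Q: "Q \<subseteq> cone_of (f ` D)"
    unfolding Q_def using convex_hull_subset_cone_of[OF adm S] .
  have "gen_inv D f ` Q \<subseteq> D"
    using gen_inv_cases[OF adm] Q by (metis image_subsetI subsetD)
  moreover have "bajraktarevic D f n x l \<in> gen_inv D f ` Q"
    if x: "x \<in> {1..n} \<rightarrow>\<^sub>E gen_inv D f ` Q" and l: "l \<in> weights n" for n x l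
  proof -
    \<comment> \<open>Only the ray of a preimage in \<open>Q\<close> is recovered from \<open>x k\<close>, so \<open>f (x k)\<close> is located
      in the cone over \<open>Q\<close> and not in \<open>Q\<close> itself.\<close>
    have "f (x k) \<in> cone_of Q" if k: "k \<in> {1..n}" for k
    proof -
      obtain y where y: "y \<in> Q" "x k = gen_inv D f y"
        using x k by blast
      obtain c where c: "0 < c" "y = c *\<^sub>R f (x k)"
        using gen_inv_cases[OF adm subsetD[OF Q y(1)], folded y(2)] .
      then have "f (x k) = inverse c *\<^sub>R y"
        by simp
      moreover have "0 < inverse c"
        using c(1) by simp
      ultimately show ?thesis
        using y(1) unfolding cone_of_def by blast
    qed
    then have "(\<Sum>k=1..n. l k *\<^sub>R f (x k)) \<in> cone_of Q"
      using weights_nonneg[OF l] weights_nonzero[OF l]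
      by (intro sum_mem_cone_of) (simp_all add: Q_def)
    then obtain c y where cy: "0 < c" "y \<in> Q" "(\<Sum>k=1..n. l k *\<^sub>R f (x k)) = c *\<^sub>R y"
      unfolding cone_of_def by blast
    have "bajraktarevic D f n x l = gen_inv D f y"
      unfolding bajraktarevic_def cy(3)
      using gen_inv_scaleR[OF adm subsetD[OF Q cy(2)] cy(1)] .
    with cy(2) show ?thesis
      by blast
  qed
  ultimately show ?thesis
    unfolding f_convex_def Q_def by blast
qed

lemma gen_inv_convex_hull_subset:
  assumes T: "f_convex D f T" and S: "S \<subseteq> T"
  shows "gen_inv D f ` (convex hull (f ` S)) \<subseteq> T"
proof
  fix d assume "d \<in> gen_inv D f ` (convex hull (f ` S))"
  then obtain n u z where
    u: "\<forall>k\<in>{1..n::nat}. 0 \<le> u k \<and> z k \<in> f ` S" "sum u {1..n} = 1" and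
    d: "d = gen_inv D f (\<Sum>k=1..n. u k *\<^sub>R z k)"
    unfolding convex_hull_indexed by auto
  have "\<forall>k\<in>{1..n}. \<exists>a. a \<in> S \<and> z k = f a"
    using u(1) by blast
  then obtain s where s: "\<forall>k\<in>{1..n}. s k \<in> S \<and> z k = f (s k)"
    unfolding bchoice_iff by (elim exE)
  define x where "x = restrict s {1..n}"
  define l where "l = restrict u {1..n}"
  have "x \<in> {1..n} \<rightarrow>\<^sub>E T"
    using s S unfolding x_def by auto
  moreover have "l \<in> weights n"
  proof -
    have "sum l {1..n} = 1"
      using u(2) unfolding l_def by simp
    then have "l \<noteq> (\<lambda>k\<in>{1..n}. 0)"
      by auto
    then show ?thesis
      using u(1) unfolding weights_def l_def by auto
  qed
  moreover have "bajraktarevic D f n x l = d"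
    unfolding bajraktarevic_def d x_def l_def
    using s by (intro arg_cong[of _ _ "gen_inv D f"] sum.cong) simp_all
  ultimately show "d \<in> T"
    using T unfolding f_convex_def by blast
qed

theorem proposition5p4:
  fixes D S :: "'d set"
    and f :: "'d \<Rightarrow> 'x::real_vector"
  assumes "admissible D f"
    and "S \<subseteq> D"
  shows "conv_f D f S = gen_inv D f ` (convex hull (f ` S))"
  unfolding conv_f_def
proof (rule hull_unique)
  show "S \<subseteq> gen_inv D f ` (convex hull (f ` S))"
  proof
    fix s assume s: "s \<in> S"
    then have "s = gen_inv D f (f s)"
      using gen_inv_scaleR_image[OF assms(1), of s 1] assms(2) by auto
    with s show "s \<in> gen_inv D f ` (convex hull (f ` S))"
      by (metis hull_inc imageI)
  qed
qed (simp_all only: f_convex_gen_inv_image[OF assms] gen_inv_convex_hull_subset)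

end
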